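(* Let $G$ be a complete geometric graph. Then every blocker for $\mathcal{T}_{\leq 3}(G)$ is either a star of $G$ or a caterpillar having a spine whose two terminal edges lie on the boundary of $\mathrm{conv}(G)$.
   Context: A geometric graph is a graph whose vertices are points in the plane in general position (no three collinear) and whose edges are straight segments between pairs of vertices; $G$ is complete if all pairs of vertices are joined. $\mathrm{conv}(G)$ is the convex hull of $V(G)$. $\mathcal{T}_{\leq k}(G)$ denotes the family of all simple (non-crossing) spanning trees of $G$ of (graph) diameter at most $k$. A subgraph $B$ blocks a family $\mathcal{F}$ of subgraphs if it shares at least one edge with every member of $\mathcal{F}$; a blocker of $\mathcal{F}$ is a subgraph that blocks $\mathcal{F}$ and has the smallest possible number of edges among all subgraphs blocking $\mathcal{F}$. A star of $G$ is the set of all edges of $G$ emanating from a single vertex. A tree $T$ is a caterpillar if the graph obtained by deleting all leaves of $T$ and their incident edges is a path (or empty); a spine of a caterpillar is a longest path in it. *)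

theory Defs
  imports "HOL-Analysis.Analysis"
begin

type_synonym point = "real \<times> real"

definition complete_edges :: "'a set \<Rightarrow> 'a set set" where
  "complete_edges P = {{u, v} | u v. u \<in> P \<and> v \<in> P \<and> u \<noteq> v}"

definition is_walk :: "'a set set \<Rightarrow> 'a list \<Rightarrow> bool" where
  "is_walk E xs \<longleftrightarrow> xs \<noteq> [] \<and> (\<forall>i < length xs - 1. {xs ! i, xs ! Suc i} \<in> E)"

definition is_gpath :: "'a set set \<Rightarrow> 'a list \<Rightarrow> bool" where
  "is_gpath E xs \<longleftrightarrow> is_walk E xs \<and> distinct xs"

definition connected_on :: "'a set \<Rightarrow> 'a set set \<Rightarrow> bool" where
  "connected_on V E \<longleftrightarrow> (\<forall>u\<in>V. \<forall>v\<in>V. \<exists>xs. is_walk E xs \<and> hd xs = u \<and> last xs = v)"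

definition acyclic_graph :: "'a set set \<Rightarrow> bool" where
  "acyclic_graph E \<longleftrightarrow> \<not> (\<exists>xs. is_gpath E xs \<and> length xs \<ge> 3 \<and> {last xs, hd xs} \<in> E)"

definition spanning_tree :: "'a set \<Rightarrow> 'a set set \<Rightarrow> bool" where
  "spanning_tree P T \<longleftrightarrow> T \<subseteq> complete_edges P \<and> connected_on P T \<and> acyclic_graph T"

definition diam_le :: "'a set \<Rightarrow> 'a set set \<Rightarrow> nat \<Rightarrow> bool" where
  "diam_le V E k \<longleftrightarrow>
     (\<forall>u\<in>V. \<forall>v\<in>V. \<exists>xs. is_walk E xs \<and> hd xs = u \<and> last xs = v \<and> length xs \<le> k + 1)"

definition verts :: "'a set set \<Rightarrow> 'a set" where
  "verts E = \<Union>E"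

definition is_tree :: "'a set set \<Rightarrow> bool" where
  "is_tree E \<longleftrightarrow> E \<noteq> {} \<and> (\<forall>e\<in>E. card e = 2) \<and> connected_on (verts E) E \<and> acyclic_graph E"

definition degree :: "'a set set \<Rightarrow> 'a \<Rightarrow> nat" where
  "degree E v = card {e \<in> E. v \<in> e}"

definition leaves :: "'a set set \<Rightarrow> 'a set" where
  "leaves E = {v \<in> verts E. degree E v = 1}"

definition path_or_empty :: "'a set \<Rightarrow> 'a set set \<Rightarrow> bool" where
  "path_or_empty V E \<longleftrightarrow> V = {} \<and> E = {} \<or>
     (\<exists>xs. distinct xs \<and> set xs = V \<and> E = {{xs ! i, xs ! Suc i} | i. i < length xs - 1})"

definition caterpillar :: "'a set set \<Rightarrow> bool" where
  "caterpillar E \<longleftrightarrow> is_tree E \<and>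
     (let V' = verts E - leaves E in path_or_empty V' {e \<in> E. e \<subseteq> V'})"

definition is_spine :: "'a set set \<Rightarrow> 'a list \<Rightarrow> bool" where
  "is_spine E xs \<longleftrightarrow> is_gpath E xs \<and> (\<forall>ys. is_gpath E ys \<longrightarrow> length ys \<le> length xs)"

definition star_of :: "'a set \<Rightarrow> 'a \<Rightarrow> 'a set set" where
  "star_of P v = {{v, w} | w. w \<in> P \<and> w \<noteq> v}"

definition blocks :: "'a set set set \<Rightarrow> 'a set set \<Rightarrow> bool" where
  "blocks F B \<longleftrightarrow> (\<forall>T\<in>F. B \<inter> T \<noteq> {})"

definition is_blocker :: "'a set \<Rightarrow> 'a set set set \<Rightarrow> 'a set set \<Rightarrow> bool" where
  "is_blocker P F B \<longleftrightarrow> B \<subseteq> complete_edges P \<and> blocks F B \<and>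
     (\<forall>B'. B' \<subseteq> complete_edges P \<longrightarrow> blocks F B' \<longrightarrow> card B \<le> card B')"

definition general_position :: "point set \<Rightarrow> bool" where
  "general_position P \<longleftrightarrow>
     (\<forall>a\<in>P. \<forall>b\<in>P. \<forall>c\<in>P. a \<noteq> b \<and> a \<noteq> c \<and> b \<noteq> c \<longrightarrow> \<not> collinear {a, b, c})"

definition noncrossing :: "point set set \<Rightarrow> bool" where
  "noncrossing T \<longleftrightarrow> (\<forall>a b c d. {a, b} \<in> T \<longrightarrow> {c, d} \<in> T \<longrightarrow> {a, b} \<noteq> {c, d} \<longrightarrow>
       closed_segment a b \<inter> closed_segment c d \<subseteq> {a, b} \<inter> {c, d})"

definition simple_trees_diam_le :: "point set \<Rightarrow> nat \<Rightarrow> point set set set" where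
  "simple_trees_diam_le P k = {T. spanning_tree P T \<and> noncrossing T \<and> diam_le P T k}"

end

theory Submission
  imports Defs
begin

text \<open>
  Every star of \<open>P\<close> blocks all spanning trees, so a blocker \<open>B\<close> has at most \<open>|P| - 1\<close> edges.
  If \<open>uv\<close> is not an edge of \<open>B\<close>, then \<open>u\<close> and \<open>v\<close> have a common neighbour in \<open>B\<close>, or neighbours
  \<open>w'\<close> of \<open>u\<close> and \<open>w\<close> of \<open>v\<close> such that \<open>u v w w'\<close> is a convex quadrilateral: otherwise
  there is a simple double star with central edge \<open>uv\<close> that avoids \<open>B\<close>.

  By counting, \<open>B\<close> has a leaf \<open>u\<close>; let \<open>p\<close> be its neighbour. Every vertex \<open>v\<close> not adjacent to \<open>p\<close>
  has a neighbour \<open>w\<close> with \<open>u v w p\<close> convex. For fixed \<open>u\<close> and \<open>p\<close> this is a strict partial order,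
  so walking upwards leads to \<open>p\<close>, and \<open>B\<close> is a tree, rooted at \<open>p\<close>, with \<open>w\<close> as the parent
  of \<open>v\<close>.

  Suppose \<open>B\<close> is not a star and let \<open>p\<close> be an inner vertex with only one inner neighbour \<open>q\<close>. For
  every leaf \<open>u\<close> of \<open>p\<close> the rest of \<open>P\<close> lies on one side of the line \<open>pu\<close>, with \<open>q\<close> angularly
  (at \<open>p\<close>) the farthest from \<open>u\<close>. Hence all leaves of \<open>p\<close> lie on the same side of \<open>q\<close>, and the
  extreme one spans a hull edge with \<open>p\<close>. For leaves \<open>u, u'\<close> of two such vertices \<open>p, p'\<close> the
  quadrilateral \<open>u u' p' p\<close> is convex, so these sides have opposite orientations and there are at
  most two such vertices. A tree with at most two leaves is a path, so the inner vertices form a path.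
\<close>

section \<open>Orientation and convex quadrilaterals\<close>

text \<open>Twice the signed area of the triangle \<open>a b c\<close>, positive for
  counterclockwise order.\<close>

definition orient :: "point \<Rightarrow> point \<Rightarrow> point \<Rightarrow> real" where
  "orient a b c = (fst b - fst a) * (snd c - snd a) - (snd b - snd a) * (fst c - fst a)"

lemma orient_rotate: "orient b c a = orient a b c"
  by (simp add: orient_def algebra_simps)

lemma orient_swap: "orient b a c = - orient a b c"
  by (simp add: orient_def algebra_simps)

lemma orient_swap': "orient a c b = - orient a b c"
  by (simp add: orient_def algebra_simps)

lemma orient_degenerate [simp]: "orient a a b = 0" "orient a b a = 0" "orient b a a = 0"
  by (simp_all add: orient_def algebra_simps)

text \<open>Three-term Grassmann-Pluecker relation for the vectors from \<open>p\<close>, the source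
  of transitivity for angular order at \<open>p\<close>.\<close>

lemma orient_pluecker:
  "orient p a c * orient p b d = orient p a b * orient p c d + orient p a d * orient p b c"
  by (simp add: orient_def algebra_simps)

lemma orient_line: "orient a b ((1 - t) *\<^sub>R c + t *\<^sub>R d) = (1 - t) * orient a b c + t * orient a b d"
  by (simp add: orient_def algebra_simps)

lemma orient_nonzero:
  assumes "\<not> collinear {a, b, c}"
  shows "orient a b c \<noteq> 0"
proof
  assume z: "orient a b c = 0"
  obtain a1 a2 b1 b2 c1 c2 where ab: "a = (a1,a2)" "b = (b1,b2)" "c = (c1,c2)"
    by (metis surj_pair)
  have "a \<noteq> b" using assms by (auto simp: insert_commute)
  hence n: "b1 - a1 \<noteq> 0 \<or> b2 - a2 \<noteq> 0" by (auto simp: ab)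
  have z': "(b1 - a1) * (c2 - a2) = (b2 - a2) * (c1 - a1)"
    using z by (simp add: orient_def ab)
  have "\<exists>k. c - a = k *\<^sub>R (b - a)"
  proof (cases "b1 - a1 = 0")
    case True
    then have "c - a = ((c2 - a2) / (b2 - a2)) *\<^sub>R (b - a)"
      using n z' by (auto simp: ab)
    then show ?thesis by blast
  next
    case False
    then have "c - a = ((c1 - a1) / (b1 - a1)) *\<^sub>R (b - a)"
      using z' by (auto simp: ab field_simps)
    then show ?thesis by blast
  qed
  then obtain k where "c - a = k *\<^sub>R (b - a)" ..
  hence "c = (1 - k) *\<^sub>R a + k *\<^sub>R b" by (simp add: algebra_simps)
  hence "collinear {a, c, b}"
    by (auto simp: collinear_3_expand algebra_simps intro!: exI[of _ "1 - k"])
  thus False using assms by (simp add: insert_commute)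
qed

lemma orient_general_position:
  assumes "general_position P" "a \<in> P" "b \<in> P" "c \<in> P" "a \<noteq> b" "a \<noteq> c" "b \<noteq> c"
  shows "orient a b c \<noteq> 0"
  using assms orient_nonzero unfolding general_position_def by blast

text \<open>The vertices are in cyclic order. In general position, this says that the segments \<open>uw\<close> and
  \<open>vx\<close> cross; for fixed \<open>u\<close> and \<open>v\<close> it is a strict partial order in \<open>w\<close> and \<open>x\<close>.\<close>

definition convex_quad :: "point \<Rightarrow> point \<Rightarrow> point \<Rightarrow> point \<Rightarrow> bool" where
  "convex_quad u v w x \<longleftrightarrow> 0 < orient u v w * orient u v x \<and> 0 < orient u v w * orient u w x
     \<and> 0 < orient u v w * orient v w x"

lemma same_sign_trans:
  fixes a b c :: real
  assumes "0 < a * b" "0 < a * c"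
  shows "0 < b * c"
  using assms by (cases "0 < a") (auto simp: zero_less_mult_iff)

text \<open>The four triples taken in cyclic order have the same orientation, and a cyclic shift
  only permutes them.\<close>

lemma convex_quad_rotate:
  assumes "convex_quad u v w x"
  shows "convex_quad v w x u"
proof -
  have [simp]: "orient v w u = orient u v w" "orient v x u = orient u v x" "orient w x u = orient u w x"
    by (rule orient_rotate)+
  have *: "0 < orient u v w * orient u v x" "0 < orient u v w * orient u w x"
    "0 < orient u v w * orient v w x"
    using assms unfolding convex_quad_def by auto
  show ?thesis unfolding convex_quad_def
    using same_sign_trans[OF *(3,1)] same_sign_trans[OF *(3,2)] *(3)
    by (simp add: mult.commute)
qed

lemma convex_quad_distinct:
  assumes "convex_quad u v w x"
  shows "u \<noteq> v" "u \<noteq> w" "u \<noteq> x" "v \<noteq> w" "v \<noteq> x" "w \<noteq> x"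
  using assms by (auto simp: convex_quad_def)

text \<open>Angular transitivity at \<open>p\<close> for points on one side of the line
  \<open>pa\<close>: both summands of the Pluecker relation, multiplied by \<open>s * s\<close>, are
  positive. The factor \<open>s\<close> covers both orientations.\<close>

lemma pluecker_sign:
  fixes s :: real
  assumes "0 < s * orient p a b" "0 < s * orient p a c" "0 < s * orient p a d"
    and "0 < s * orient p b c" "0 < s * orient p c d"
  shows "0 < s * orient p b d"
proof -
  have s: "s \<noteq> 0" using assms(1) by auto
  have "(s * orient p a c) * (s * orient p b d) =
    (s * orient p a b) * (s * orient p c d) + (s * orient p a d) * (s * orient p b c)"
    using arg_cong[OF orient_pluecker[of p a c b d], of "\<lambda>r. s * s * r"]
    by (simp only: distrib_left mult_ac)
  also have "\<dots> > 0"
    using mult_pos_pos[OF assms(1,5)] mult_pos_pos[OF assms(3,4)] by (rule add_pos_pos)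
  finally show ?thesis using assms(2) by (rule zero_less_mult_pos)
qed

text \<open>The points \<open>w\<close>, \<open>x\<close>, \<open>y\<close> lie on one side of
  \<open>uv\<close> and are angularly ordered both at \<open>u\<close> and at \<open>v\<close>, so
  \<open>pluecker_sign\<close> applies at either vertex.\<close>

lemma convex_quad_trans:
  assumes "convex_quad u v w x" "convex_quad u v x y"
  shows "convex_quad u v w y"
proof -
  define s where "s = orient u v w"
  have 0: "0 < s * orient u v w" "0 < s * orient u v x" "0 < s * orient u v y"
     "0 < s * orient u w x" "0 < s * orient u x y" "0 < s * orient v w x" "0 < s * orient v x y"
  proof -
    have a: "0 < s * s" "0 < s * orient u v x" "0 < s * orient u w x" "0 < s * orient v w x"
      using assms(1) unfolding convex_quad_def s_def by (auto simp: zero_less_mult_iff)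
    have b: "0 < orient u v x * orient u v y" "0 < orient u v x * orient u x y"
      "0 < orient u v x * orient v x y"
      using assms(2) unfolding convex_quad_def by auto
    have c: "0 < orient u v x * s" using a(2) by (simp add: mult.commute)
    show "0 < s * orient u v w" "0 < s * orient u v x" "0 < s * orient u w x" "0 < s * orient v w x"
      using a by (simp_all add: s_def)
    show "0 < s * orient u v y" "0 < s * orient u x y" "0 < s * orient v x y"
      using same_sign_trans[OF c] b by blast+
  qed
  have "0 < s * orient u w y" by (rule pluecker_sign[OF 0(1-5)])
  moreover have "0 < s * orient v w y"
  proof -
    \<comment> \<open>Seen from \<open>v\<close>, the base ray points the other way, so the sign and
      the order of the points are reversed.\<close>
    have "0 < - s * orient v y w"
      by (rule pluecker_sign[of "-s" v u y x w])
         (use 0 in \<open>simp_all add: orient_swap[of u v] orient_swap'[of v y x] orient_swap'[of v x w]\<close>)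
    thus ?thesis by (simp add: orient_swap'[of v y w])
  qed
  ultimately show ?thesis using 0 unfolding convex_quad_def s_def by simp
qed

section \<open>Crossing segments and hull edges\<close>

text \<open>\<open>orient\<close> is affine along a segment. Evaluating it at a common point along
  both segments, against the lines \<open>uv\<close>, \<open>ux\<close> and \<open>vy\<close>, ties
  the four orientations together by positive factors.\<close>

lemma closed_segments_disjoint:
  assumes gp: "general_position P" and P: "u \<in> P" "v \<in> P" "x \<in> P" "y \<in> P"
    and d: "distinct [u, v, x, y]" and nq: "\<not> convex_quad u v x y"
  shows "closed_segment u x \<inter> closed_segment v y = {}"
proof (rule ccontr)
  assume "closed_segment u x \<inter> closed_segment v y \<noteq> {}"
  then obtain z where z: "z \<in> closed_segment u x" "z \<in> closed_segment v y" by blast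
  obtain s where s: "0 \<le> s" "s \<le> 1" "z = (1 - s) *\<^sub>R u + s *\<^sub>R x"
    using z(1) unfolding closed_segment_def by auto
  obtain t where t: "0 \<le> t" "t \<le> 1" "z = (1 - t) *\<^sub>R v + t *\<^sub>R y"
    using z(2) unfolding closed_segment_def by auto
  have e: "(1 - s) *\<^sub>R u + s *\<^sub>R x = (1 - t) *\<^sub>R v + t *\<^sub>R y"
    using s(3) t(3) by simp
  have e': "\<And>a b. (1 - s) * orient a b u + s * orient a b x = (1 - t) * orient a b v + t * orient a b y"
    using e by (metis orient_line)
  have nz: "orient u v x \<noteq> 0" "orient u v y \<noteq> 0" "orient u x y \<noteq> 0" "orient v x y \<noteq> 0"
    using d P orient_general_position[OF gp] by auto
  have 1: "s * orient u v x = t * orient u v y" using e'[of u v] by simp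
  have 2: "t * orient u x y = (1 - t) * orient u v x"
    using e'[of u x] by (simp add: orient_swap'[of u x v])
  have 3: "s * orient v x y = (1 - s) * orient u v y"
    using e'[of v y] by (simp add: orient_swap'[of v y x] orient_rotate[of v y u] algebra_simps)
  \<comment> \<open>A parameter 0 or 1 would make the orientation of three of the points
    vanish.\<close>
  have st: "s \<noteq> 0" "t \<noteq> 0" "t \<noteq> 1" "s \<noteq> 1"
    using 1 2 3 nz by auto
  have pos: "0 < s" "0 < t" "0 < 1 - s" "0 < 1 - t" using s(1,2) t(1,2) st by auto
  have sgn: "c * a = d * b \<Longrightarrow> 0 < c \<Longrightarrow> 0 < d \<Longrightarrow> b \<noteq> 0 \<Longrightarrow> 0 < a * b" for a b c d :: real
  proof -
    assume h: "c * a = d * b" "0 < c" "0 < d" "b \<noteq> 0"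
    have "c * (a * b) = d * (b * b)" using h(1) by (simp add: algebra_simps)
    also have "\<dots> > 0" using h by (simp add: zero_less_mult_iff) linarith
    finally show ?thesis using h(2) by (simp add: zero_less_mult_iff)
  qed
  have *: "0 < orient u v x * orient u v y" "0 < orient u x y * orient u v x"
       "0 < orient v x y * orient u v y"
    using sgn[OF 1] sgn[OF 2] sgn[OF 3] pos nz by auto
  have "0 < orient u v y * orient u v x" "0 < orient u v y * orient v x y"
    using *(1,3) by (simp_all only: mult.commute)
  then have "0 < orient u v x * orient v x y" by (rule same_sign_trans)
  then have "convex_quad u v x y"
    unfolding convex_quad_def using * by (simp add: mult.commute)
  with nq show False ..
qed

lemma closed_segments_common_endpoint:
  assumes "orient z x y \<noteq> 0"
  shows "closed_segment z x \<inter> closed_segment z y = {z}"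
proof -
  have "p = z" if p: "p \<in> closed_segment z x" "p \<in> closed_segment z y" for p
  proof -
    obtain s where s: "p = (1 - s) *\<^sub>R z + s *\<^sub>R x" using p(1) unfolding closed_segment_def by auto
    obtain t where t: "p = (1 - t) *\<^sub>R z + t *\<^sub>R y" using p(2) unfolding closed_segment_def by auto
    have "orient z x p = 0" unfolding s orient_line by simp
    moreover have "orient z x p = t * orient z x y" unfolding t orient_line by simp
    ultimately show "p = z" using assms t by simp
  qed
  thus ?thesis by auto
qed

text \<open>A supporting line of \<open>P\<close> also supports the hull: interior points of the
  hull lie strictly on one side, while the segment lies on the line.\<close>

lemma closed_segment_subset_frontier_hull:
  assumes "p \<in> P" "u \<in> P" "p \<noteq> u" and side: "\<And>x. x \<in> P \<Longrightarrow> 0 \<le> s * orient p u x" and "s \<noteq> 0"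
  shows "closed_segment p u \<subseteq> frontier (convex hull P)"
proof -
  \<comment> \<open>A normal vector of the line \<open>pu\<close>, scaled so that
    \<open>s * orient p u x\<close> is the difference of its inner products with \<open>x\<close>
    and \<open>p\<close>.\<close>
  define n where "n = (s * (snd p - snd u), s * (fst u - fst p))"
  have n: "n \<noteq> 0" using assms by (auto simp: n_def zero_prod_def prod_eq_iff)
  have o: "s * orient p u x = n \<bullet> x - n \<bullet> p" for x
    by (simp add: orient_def n_def inner_prod_def algebra_simps)
  have "convex hull P \<subseteq> {x. n \<bullet> x \<ge> n \<bullet> p}"
    by (rule hull_minimal) (use side o in \<open>auto simp: convex_halfspace_ge\<close>)
  then have "interior (convex hull P) \<subseteq> {x. n \<bullet> x > n \<bullet> p}"
    using interior_mono interior_halfspace_ge[OF n] by blast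
  then have int: "n \<bullet> x > n \<bullet> p" if "x \<in> interior (convex hull P)" for x
    using that by blast
  have bd: "n \<bullet> x = n \<bullet> p" if x: "x \<in> closed_segment p u" for x
  proof -
    obtain t where "x = (1 - t) *\<^sub>R p + t *\<^sub>R u" using x unfolding closed_segment_def by auto
    hence "orient p u x = 0" by (simp add: orient_line)
    with o[of x] show ?thesis by simp
  qed
  have "closed_segment p u \<subseteq> convex hull P"
    by (intro closed_segment_subset_convex_hull hull_inc assms)
  then have "closed_segment p u \<subseteq> closure (convex hull P)"
    using closure_subset by (rule subset_trans)
  moreover have "closed_segment p u \<inter> interior (convex hull P) = {}"
    using int bd by (metis disjoint_iff less_irrefl)
  ultimately show ?thesis unfolding frontier_def by blast
qed

section \<open>Walks and rooted trees\<close>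

lemma rtrancl_imp_walk:
  assumes "(u, v) \<in> {(a, b). {a, b} \<in> E}\<^sup>*"
  shows "\<exists>xs. is_walk E xs \<and> hd xs = u \<and> last xs = v"
  using assms
proof (induction rule: converse_rtrancl_induct)
  case base
  show ?case by (rule exI[of _ "[v]"]) (simp add: is_walk_def)
next
  case (step y z)
  then obtain xs where xs: "is_walk E xs" "hd xs = z" "last xs = v" by blast
  have ne: "xs \<noteq> []" using xs(1) by (simp add: is_walk_def)
  have "{(y # xs) ! i, (y # xs) ! Suc i} \<in> E" if "i < length xs" for i
  proof (cases i)
    case 0
    then show ?thesis using step(1) xs(2) ne by (simp add: hd_conv_nth)
  next
    case (Suc j)
    then show ?thesis using that xs(1) by (simp add: is_walk_def)
  qed
  then have "is_walk E (y # xs)" by (simp add: is_walk_def)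
  then show ?case using xs ne by (intro exI[of _ "y # xs"]) simp
qed

lemma walk_closed:
  assumes "is_walk E xs" "hd xs \<in> X" and "\<And>a b. {a, b} \<in> E \<Longrightarrow> a \<in> X \<Longrightarrow> b \<in> X"
  shows "last xs \<in> X"
proof -
  have ne: "xs \<noteq> []" using assms(1) by (simp add: is_walk_def)
  have "i < length xs \<Longrightarrow> xs ! i \<in> X" for i
  proof (induction i)
    case 0
    then show ?case using assms(2) ne by (simp add: hd_conv_nth)
  next
    case (Suc i)
    then have "{xs ! i, xs ! Suc i} \<in> E" using assms(1) by (simp add: is_walk_def)
    then show ?case using Suc assms(3) by auto
  qed
  then show ?thesis using ne by (simp add: last_conv_nth)
qed

text \<open>Connectedness as an induction principle, for showing that a path, a neighbourhood or a
  single vertex exhausts \<open>V\<close>.\<close>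

lemma connected_on_closed:
  assumes "connected_on V E" "x \<in> V" "x \<in> X" "\<And>a b. {a, b} \<in> E \<Longrightarrow> a \<in> X \<Longrightarrow> b \<in> X"
  shows "V \<subseteq> X"
proof
  fix y assume "y \<in> V"
  then obtain xs where "is_walk E xs" "hd xs = x" "last xs = y"
    using assms(1,2) unfolding connected_on_def by metis
  then show "y \<in> X" using walk_closed[of E xs X] assms(3,4) by auto
qed

section \<open>Trees encoded by a parent function\<close>

text \<open>Parent function and rank certify a tree: descending reaches the root, and on a cycle the
  vertex of greatest rank would have two parents.\<close>

definition rooted_tree :: "'a set \<Rightarrow> 'a set set \<Rightarrow> 'a \<Rightarrow> ('a \<Rightarrow> 'a) \<Rightarrow> ('a \<Rightarrow> nat) \<Rightarrow> bool" where
  "rooted_tree V E r par rk \<longleftrightarrow> r \<in> V \<and> E = (\<lambda>v. {v, par v}) ` (V - {r})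
     \<and> (\<forall>v\<in>V - {r}. par v \<in> V \<and> rk (par v) < rk v)"

lemma rooted_tree_connected:
  assumes "rooted_tree V E r par rk"
  shows "connected_on V E"
proof -
  let ?R = "{(a, b). {a, b} \<in> E}"
  have root: "(v, r) \<in> ?R\<^sup>*" if "v \<in> V" for v
    using that
  proof (induction "rk v" arbitrary: v rule: less_induct)
    case less
    show ?case
    proof (cases "v = r")
      case False
      then have "par v \<in> V" "rk (par v) < rk v" "(v, par v) \<in> ?R"
        using assms less.prems unfolding rooted_tree_def by auto
      then show ?thesis using less.hyps by (meson converse_rtrancl_into_rtrancl)
    qed simp
  qed
  have "sym (?R\<^sup>*)" by (rule sym_rtrancl) (auto simp: sym_def insert_commute)
  then have "(u, v) \<in> ?R\<^sup>*" if "u \<in> V" "v \<in> V" for u v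
    using root[OF that(1)] root[OF that(2)] by (meson rtrancl_trans symD)
  then show ?thesis
    unfolding connected_on_def by (intro ballI rtrancl_imp_walk)
qed

lemma rooted_tree_edgeD:
  assumes "rooted_tree V E r par rk" "{a, b} \<in> E"
  shows "(b = par a \<and> rk b < rk a) \<or> (a = par b \<and> rk a < rk b)"
  using assms unfolding rooted_tree_def by (auto simp: doubleton_eq_iff)

lemma rooted_tree_acyclic:
  assumes "rooted_tree V E r par rk"
  shows "acyclic_graph E"
  unfolding acyclic_graph_def
proof clarify
  fix xs assume p: "is_gpath E xs" and len: "3 \<le> length xs" and c: "{last xs, hd xs} \<in> E"
  define k where "k = length xs"
  have ne: "xs \<noteq> []" using len by auto
  have edge: "{xs ! i, xs ! Suc i} \<in> E" if "Suc i < k" for i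
    using p that unfolding is_gpath_def is_walk_def k_def by auto
  have edge': "{xs ! (k - 1), xs ! 0} \<in> E"
    using c ne by (simp add: k_def hd_conv_nth last_conv_nth)
  have "Max (rk ` set xs) \<in> rk ` set xs" using ne by (intro Max_in) auto
  then obtain x where "x \<in> set xs" "rk x = Max (rk ` set xs)" by auto
  then have x: "x \<in> set xs" "\<And>y. y \<in> set xs \<Longrightarrow> rk y \<le> rk x" by simp_all
  then obtain m where m: "m < k" "x = xs ! m" by (auto simp: in_set_conv_nth k_def)
  \<comment> \<open>Cyclic successor and predecessor of the vertex of greatest rank; they differ
    because the cycle has at least three vertices.\<close>
  define i where "i = (if Suc m = k then 0 else Suc m)"
  define j where "j = (if m = 0 then k - 1 else m - 1)"
  have ij: "i < k" "j < k" "i \<noteq> j" using m len by (auto simp: i_def j_def k_def)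
  have "{x, xs ! i} \<in> E" using edge[of m] edge' m by (auto simp: i_def)
  moreover have "{x, xs ! j} \<in> E"
    using edge[of "m - 1"] edge' m by (auto simp: j_def insert_commute)
  moreover have "rk (xs ! i) \<le> rk x" "rk (xs ! j) \<le> rk x"
    using x(2) ij by (auto simp: k_def)
  ultimately have "xs ! i = par x" "xs ! j = par x"
    using rooted_tree_edgeD[OF assms] not_le by blast+
  then show False using p ij nth_eq_iff_index_eq[of xs i j]
    by (auto simp: is_gpath_def k_def)
qed

lemma rooted_tree_card_edges:
  assumes "rooted_tree V E r par rk" "finite V"
  shows "card E = card V - 1"
proof -
  have "inj_on (\<lambda>v. {v, par v}) (V - {r})"
  proof (rule inj_onI)
    fix x y assume "x \<in> V - {r}" "y \<in> V - {r}" "{x, par x} = {y, par y}"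
    moreover from this have "rk (par x) < rk x" "rk (par y) < rk y"
      using assms(1) unfolding rooted_tree_def by auto
    ultimately show "x = y" by (auto simp: doubleton_eq_iff)
  qed
  then show ?thesis using assms unfolding rooted_tree_def by (auto simp: card_image)
qed

text \<open>The parent edges alone number \<open>card V - 1\<close>, so the bound on
  \<open>card E\<close> leaves room for no other edge.\<close>

lemma rooted_treeI:
  assumes "finite V" "r \<in> V" "finite E" "card E \<le> card V - 1"
    and par: "\<And>v. v \<in> V - {r} \<Longrightarrow> par v \<in> V \<and> {v, par v} \<in> E \<and> rk (par v) < rk v"
  shows "rooted_tree V E r par rk"
proof -
  let ?E = "(\<lambda>v. {v, par v}) ` (V - {r})"
  have t: "rooted_tree V ?E r par rk" using assms unfolding rooted_tree_def by auto
  have "?E \<subseteq> E" using par by auto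
  moreover have "card E \<le> card ?E" using assms rooted_tree_card_edges[OF t] by simp
  ultimately have "?E = E" using assms(3) by (simp add: card_seteq)
  then show ?thesis using t by simp
qed

section \<open>Degree counting and paths\<close>

lemma sum_degree:
  assumes "finite V" "finite E" "\<And>e. e \<in> E \<Longrightarrow> e \<subseteq> V \<and> card e = 2"
  shows "(\<Sum>v\<in>V. degree E v) = 2 * card E"
proof -
  have "(\<Sum>v\<in>V. degree E v) = (\<Sum>e\<in>E. card {v \<in> V. v \<in> e})"
    unfolding degree_def by (rule sum_multicount_gen[OF assms(1,2)]) simp
  also have "\<dots> = (\<Sum>e\<in>E. 2)"
  proof (rule sum.cong[OF refl])
    fix e assume "e \<in> E"
    then have "{v \<in> V. v \<in> e} = e" "card e = 2" using assms(3) by auto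
    then show "card {v \<in> V. v \<in> e} = 2" by simp
  qed
  finally show ?thesis by simp
qed

lemma degree_eq_card_neighbours:
  assumes "\<And>e. e \<in> E \<Longrightarrow> card e = 2"
  shows "degree E v = card {w. {v, w} \<in> E}"
proof -
  have "{e \<in> E. v \<in> e} = (\<lambda>w. {v, w}) ` {w. {v, w} \<in> E}"
  proof (intro equalityI subsetI)
    fix e assume e: "e \<in> {e \<in> E. v \<in> e}"
    then have "card e = 2" using assms by blast
    then obtain a b where "e = {a, b}" "a \<noteq> b" unfolding card_2_iff by blast
    then have "\<exists>w. e = {v, w}" using e by (auto simp: insert_commute)
    then show "e \<in> (\<lambda>w. {v, w}) ` {w. {v, w} \<in> E}" using e by auto
  qed auto
  moreover have "inj_on (\<lambda>w. {v, w}) {w. {v, w} \<in> E}"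
    by (rule inj_onI) (auto simp: doubleton_eq_iff)
  ultimately show ?thesis unfolding degree_def by (simp add: card_image)
qed

text \<open>A longest path cannot be prolonged at its ends, and its other vertices spend both their
  edges on the path. So it is closed under adjacency and covers \<open>V\<close>.\<close>

lemma path_if_degree_le_2:
  assumes fin: "finite V" "finite E" and ne: "V \<noteq> {}" and conn: "connected_on V E"
    and card: "card E = card V - 1" and sub: "\<And>e. e \<in> E \<Longrightarrow> e \<subseteq> V \<and> card e = 2"
    and deg: "\<And>v. v \<in> V \<Longrightarrow> degree E v \<le> 2"
  shows "\<exists>xs. distinct xs \<and> set xs = V \<and> E = {{xs ! i, xs ! Suc i} | i. i < length xs - 1}"
proof -
  define Q where "Q xs \<longleftrightarrow> is_gpath E xs \<and> set xs \<subseteq> V" for xs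
  obtain v where v: "v \<in> V" using ne by blast
  have "Q [v]" using v by (simp add: Q_def is_gpath_def is_walk_def)
  moreover have "\<forall>xs. Q xs \<longrightarrow> length xs < Suc (card V)"
    unfolding Q_def is_gpath_def using fin(1) by (metis card_mono distinct_card le_imp_less_Suc)
  ultimately have "\<exists>xs. Q xs \<and> (\<forall>ys. Q ys \<longrightarrow> length ys \<le> length xs)"
    by (intro ex_has_greatest_nat)
  then obtain xs where xs: "Q xs" "\<And>ys. Q ys \<Longrightarrow> length ys \<le> length xs" by auto
  have d: "distinct xs" and xne: "xs \<noteq> []" and sV: "set xs \<subseteq> V"
    and edge: "\<And>i. Suc i < length xs \<Longrightarrow> {xs ! i, xs ! Suc i} \<in> E"
    using xs(1) by (auto simp: Q_def is_gpath_def is_walk_def)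
  have closed: "b \<in> set xs" if e: "{a, b} \<in> E" and a: "a \<in> set xs" for a b
  proof (rule ccontr)
    assume b: "b \<notin> set xs"
    have bV: "b \<in> V" using sub[OF e] by auto
    obtain i where i: "i < length xs" "a = xs ! i" using a by (auto simp: in_set_conv_nth)
    consider "i = 0" | "Suc i = length xs" | "0 < i" "Suc i < length xs" using i by linarith
    then show False
    proof cases
      case 1
      have "{(b # xs) ! j, (b # xs) ! Suc j} \<in> E" if "j < length xs" for j
        using that edge e i 1 by (cases j) (auto simp: insert_commute)
      then have "Q (b # xs)" using b bV d sV by (auto simp: Q_def is_gpath_def is_walk_def)
      then show False using xs(2)[of "b # xs"] by simp
    next
      case 2
      have "{(xs @ [b]) ! j, (xs @ [b]) ! Suc j} \<in> E" if "j < length xs" for j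
      proof (cases "Suc j = length xs")
        case True
        then have "j = i" using 2 by simp
        then show ?thesis using e i True by (simp add: nth_append)
      next
        case False
        then show ?thesis using that edge[of j] by (simp add: nth_append)
      qed
      then have "Q (xs @ [b])" using b bV d sV by (auto simp: Q_def is_gpath_def is_walk_def)
      then show False using xs(2)[of "xs @ [b]"] by simp
    next
      case 3
      let ?x = "xs ! (i - 1)" and ?y = "xs ! Suc i"
      have 0: "?x \<in> set xs" "?y \<in> set xs" "?x \<noteq> ?y" "?x \<noteq> a" "?y \<noteq> a"
        using 3 i d by (auto simp: nth_eq_iff_index_eq)
      have "{{a, ?x}, {a, ?y}, {a, b}} \<subseteq> {e \<in> E. a \<in> e}"
        using edge[of "i - 1"] edge[of i] 3 i e by (auto simp: insert_commute)
      moreover have "card {{a, ?x}, {a, ?y}, {a, b}} = 3"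
        using 0 b by (auto simp: doubleton_eq_iff card_insert_if)
      ultimately have "3 \<le> degree E a"
        unfolding degree_def using fin(2) card_mono[of "{e \<in> E. a \<in> e}" "{{a, ?x}, {a, ?y}, {a, b}}"]
        by simp
      then show False using deg[of a] a sV by auto
    qed
  qed
  have x0: "xs ! 0 \<in> set xs" using xne by simp
  have "V \<subseteq> set xs"
    by (rule connected_on_closed[OF conn _ x0]) (use x0 sV closed in \<open>blast+\<close>)
  then have V: "set xs = V" using sV by blast
  let ?E = "(\<lambda>i. {xs ! i, xs ! Suc i}) ` {..<length xs - 1}"
  have "inj_on (\<lambda>i. {xs ! i, xs ! Suc i}) {..<length xs - 1}"
    using d by (intro inj_onI) (auto simp: doubleton_eq_iff nth_eq_iff_index_eq)
  \<comment> \<open>The path already has \<open>card V - 1\<close> edges, so no closing edge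
    remains.\<close>
  then have "card ?E = card V - 1" using V d by (simp add: card_image flip: distinct_card)
  moreover have "?E \<subseteq> E" using edge by auto
  ultimately have "?E = E" using card fin(2) by (simp add: card_seteq)
  then have "E = {{xs ! i, xs ! Suc i} | i. i < length xs - 1}" by auto
  then show ?thesis using d V by blast
qed

section \<open>Edge sets that block all double stars\<close>

definition leaf_at :: "'a set set \<Rightarrow> 'a \<Rightarrow> 'a \<Rightarrow> bool" where
  "leaf_at B u p \<longleftrightarrow> {u, p} \<in> B \<and> (\<forall>w. {u, w} \<in> B \<longrightarrow> w = p)"

text \<open>The bound on \<open>card B\<close> comes from comparison with a star, the condition
  \<open>block\<close> from simple double stars with centres \<open>u\<close> and
  \<open>v\<close>.\<close>

locale double_star_blocker =
  fixes P :: "point set" and B :: "point set set"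
  assumes fin: "finite P" and gp: "general_position P" and card_P: "2 \<le> card P"
    and B_edges: "B \<subseteq> complete_edges P" and card_B: "card B \<le> card P - 1"
    and block: "\<And>u v. u \<in> P \<Longrightarrow> v \<in> P \<Longrightarrow> u \<noteq> v \<Longrightarrow> {u, v} \<notin> B \<Longrightarrow>
      \<exists>w w'. {v, w} \<in> B \<and> {u, w'} \<in> B \<and> (w = w' \<or> convex_quad u v w w')"
begin

lemma edgeD:
  assumes "{a, b} \<in> B"
  shows "a \<in> P" "b \<in> P" "a \<noteq> b" "{b, a} \<in> B"
  using assms B_edges by (auto simp: complete_edges_def doubleton_eq_iff insert_commute)

lemma edge_card: "e \<in> B \<Longrightarrow> e \<subseteq> P \<and> card e = 2"
  using B_edges by (auto simp: complete_edges_def)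

lemma finite_B: "finite B"
proof -
  have "B \<subseteq> Pow P" using edge_card by blast
  then show ?thesis using fin by (meson finite_Pow_iff finite_subset)
qed

lemma degree_B: "degree B v = card {w. {v, w} \<in> B}"
  by (rule degree_eq_card_neighbours) (simp add: edge_card)

lemma finite_neighbours: "finite {w. {v, w} \<in> B}"
  by (rule finite_subset[OF _ fin]) (auto dest: edgeD)

lemma neighbour_exists:
  assumes "v \<in> P" shows "\<exists>w. {v, w} \<in> B"
proof -
  have "card (P - {v}) \<noteq> 0" using card_P assms by simp
  then obtain u where "u \<in> P" "u \<noteq> v" by (metis card.empty Diff_iff ex_in_conv insert_iff)
  then show ?thesis using block[of u v] assms edgeD(4) by blast
qed

lemma degree_eq_1_iff: "degree B v = 1 \<longleftrightarrow> (\<exists>p. leaf_at B v p)"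
  unfolding degree_B card_1_singleton_iff leaf_at_def One_nat_def by blast

lemma verts_B: "verts B = P"
  using edge_card neighbour_exists unfolding verts_def by blast

text \<open>If all degrees were at least 2, the degree sum would force \<open>card P\<close>
  edges.\<close>

lemma leaf_exists: "\<exists>u p. leaf_at B u p"
proof (rule ccontr)
  assume no: "\<not> ?thesis"
  have "2 \<le> degree B v" if "v \<in> P" for v
  proof -
    have "degree B v \<noteq> 1" using no degree_eq_1_iff by blast
    moreover have "degree B v \<noteq> 0"
      using neighbour_exists[OF that] finite_neighbours[of v] by (auto simp: degree_B)
    ultimately show ?thesis by linarith
  qed
  then have "card P * 2 \<le> (\<Sum>v\<in>P. degree B v)" using sum_bounded_below[of P 2 "degree B"] by auto
  also have "\<dots> = 2 * card B" by (rule sum_degree[OF fin finite_B edge_card])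
  finally show False using card_B card_P by simp
qed

text \<open>The only neighbour of \<open>u\<close> is \<open>p\<close>, so \<open>block\<close> must
  choose \<open>w' = p\<close>; then \<open>w = w'\<close> fails because \<open>v\<close> is not
  adjacent to \<open>p\<close>.\<close>

lemma parent_exists:
  assumes "leaf_at B u p" "v \<in> P" "v \<noteq> p" "v \<noteq> u" "{v, p} \<notin> B"
  shows "\<exists>w. {v, w} \<in> B \<and> convex_quad p u v w"
proof -
  have "u \<in> P" "{u, v} \<notin> B" using assms edgeD unfolding leaf_at_def by blast+
  then obtain w w' where w: "{v, w} \<in> B" "{u, w'} \<in> B" "w = w' \<or> convex_quad u v w w'"
    using block[of u v] assms by blast
  then have "w' = p" using assms(1) unfolding leaf_at_def by blast
  then have "convex_quad u v w p" using w assms(5) by blast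
  \<comment> \<open>Three cyclic shifts turn \<open>u v w p\<close> into
    \<open>p u v w\<close>.\<close>
  from convex_quad_rotate[OF convex_quad_rotate[OF convex_quad_rotate[OF this]]]
  have "convex_quad p u v w" .
  then show ?thesis using w(1) by blast
qed

text \<open>Counts the points above \<open>v\<close> in the order with base \<open>p u\<close>, so
  that parents get smaller values; \<open>Suc\<close> reserves 0 for the root
  \<open>p\<close>.\<close>

definition rank :: "point \<Rightarrow> point \<Rightarrow> point \<Rightarrow> nat" where
  "rank u p v = (if v = p then 0 else Suc (card {x \<in> P. convex_quad p u v x}))"

lemma rank_less:
  assumes "convex_quad p u v w" "w \<in> P"
  shows "rank u p w < rank u p v"
proof -
  have "{x \<in> P. convex_quad p u w x} \<subset> {x \<in> P. convex_quad p u v x}"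
  proof (rule psubsetI)
    show "{x \<in> P. convex_quad p u w x} \<subseteq> {x \<in> P. convex_quad p u v x}"
      using convex_quad_trans[OF assms(1)] by auto
    have "w \<notin> {x \<in> P. convex_quad p u w x}" using convex_quad_distinct(6) by blast
    then show "{x \<in> P. convex_quad p u w x} \<noteq> {x \<in> P. convex_quad p u v x}" using assms by blast
  qed
  then have "card {x \<in> P. convex_quad p u w x} < card {x \<in> P. convex_quad p u v x}"
    using fin by (simp add: psubset_card_mono)
  then show ?thesis using convex_quad_distinct[OF assms(1)] by (simp add: rank_def)
qed

text \<open>Neighbours of \<open>p\<close> get the parent \<open>p\<close>, all others the vertex
  from \<open>parent_exists\<close>. The bound on \<open>card B\<close> then excludes further
  edges.\<close>

lemma rooted_at_leaf_neighbour:
  assumes leaf: "leaf_at B u p"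
  shows "\<exists>par. rooted_tree P B p par (rank u p)"
proof -
  have "\<exists>w. w \<in> P \<and> {v, w} \<in> B \<and> rank u p w < rank u p v" if v: "v \<in> P - {p}" for v
  proof (cases "{v, p} \<in> B")
    case True
    then show ?thesis using edgeD[OF True] v by (intro exI[of _ p]) (auto simp: rank_def)
  next
    case False
    then have "v \<noteq> u" using leaf by (auto simp: leaf_at_def)
    then obtain w where "{v, w} \<in> B" "convex_quad p u v w" using parent_exists[OF leaf] v False by blast
    then show ?thesis using rank_less edgeD(2) by blast
  qed
  then obtain par where par: "\<And>v. v \<in> P - {p} \<Longrightarrow>
    par v \<in> P \<and> {v, par v} \<in> B \<and> rank u p (par v) < rank u p v" by metis
  have "p \<in> P" using leaf edgeD unfolding leaf_at_def by blast
  then show ?thesis using rooted_treeI[OF fin _ finite_B card_B par] by blast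
qed

lemma connected_B: "connected_on P B" and acyclic_B: "acyclic_graph B"
  using leaf_exists rooted_at_leaf_neighbour rooted_tree_connected rooted_tree_acyclic by metis+

lemma is_tree_B: "is_tree B"
proof -
  have "B \<noteq> {}" using leaf_exists by (auto simp: leaf_at_def)
  then show ?thesis using edge_card connected_B acyclic_B by (simp add: is_tree_def verts_B)
qed

text \<open>\<open>v\<close> and its neighbours are closed under adjacency, hence all of
  \<open>P\<close>, and leaves at \<open>v\<close> have no edges among themselves.\<close>

lemma star_if_neighbours_leaves:
  assumes v: "v \<in> P" and leaf: "\<And>w. {v, w} \<in> B \<Longrightarrow> \<exists>p. leaf_at B w p"
  shows "B = star_of P v"
proof -
  have nb: "b = v" if "{v, a} \<in> B" "{a, b} \<in> B" for a b
    using leaf[OF that(1)] that edgeD(4) unfolding leaf_at_def by metis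
  let ?X = "insert v {w. {v, w} \<in> B}"
  have PX: "P \<subseteq> ?X"
    by (rule connected_on_closed[OF connected_B v]) (use nb in auto)
  have "e \<in> star_of P v" if "e \<in> B" for e
  proof -
    obtain a b where e: "e = {a, b}" using edge_card[OF \<open>e \<in> B\<close>] by (auto simp: card_2_iff)
    note ab = edgeD[OF that[unfolded e]]
    have "a = v \<or> {v, a} \<in> B" using ab(1) PX by auto
    then have "a = v \<or> b = v" using nb[of a b] that[unfolded e] by auto
    then show ?thesis
    proof
      assume "a = v"
      then show ?thesis unfolding star_of_def e using ab by blast
    next
      assume "b = v"
      then have "e = {v, a}" using e by auto
      then show ?thesis unfolding star_of_def using ab \<open>b = v\<close> by blast
    qed
  qed
  moreover have "star_of P v \<subseteq> B" using PX by (auto simp: star_of_def)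
  ultimately show ?thesis by blast
qed

end

section \<open>The tree of inner vertices\<close>

locale non_star_blocker = double_star_blocker +
  assumes not_star: "\<And>v. v \<in> P \<Longrightarrow> B \<noteq> star_of P v"
begin

definition inner :: "point set" where
  "inner = {v \<in> P. \<not> (\<exists>p. leaf_at B v p)}"

definition inner_edges :: "point set set" where
  "inner_edges = {e \<in> B. e \<subseteq> inner}"

lemma inner_eq: "inner = verts B - leaves B"
  unfolding inner_def leaves_def verts_B using degree_eq_1_iff by auto

lemma inner_edge_iff: "{a, b} \<in> inner_edges \<longleftrightarrow> {a, b} \<in> B \<and> a \<in> inner \<and> b \<in> inner"
  by (auto simp: inner_edges_def)

text \<open>If all neighbours of \<open>v\<close> were leaves, \<open>B\<close> would be the star at
  \<open>v\<close>.\<close>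

lemma inner_neighbour: "v \<in> P \<Longrightarrow> \<exists>w \<in> inner. {v, w} \<in> B"
  using star_if_neighbours_leaves[of v] not_star[of v] edgeD(2)[of v] unfolding inner_def by blast

lemma inner_second_neighbour:
  assumes "v \<in> inner" "{v, a} \<in> B" obtains b where "{v, b} \<in> B" "b \<noteq> a"
  using assms unfolding inner_def leaf_at_def by blast

lemma leaf_neighbour_inner: "leaf_at B u p \<Longrightarrow> p \<in> inner"
  using inner_neighbour[of u] edgeD(1) unfolding leaf_at_def by metis

text \<open>A parent is always inner: it is the root, or it has a child and its own parent as
  neighbours. So the parent function restricts to the inner vertices.\<close>

lemma inner_rooted: "\<exists>r par rk. rooted_tree inner inner_edges r par rk"
proof -
  obtain u p where leaf: "leaf_at B u p" using leaf_exists by blast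
  obtain par where r: "rooted_tree P B p par (rank u p)" using rooted_at_leaf_neighbour[OF leaf] by blast
  have p: "p \<in> inner" using leaf by (rule leaf_neighbour_inner)
  have e: "{v, par v} \<in> B" "par v \<in> P" "rank u p (par v) < rank u p v" if "v \<in> P" "v \<noteq> p" for v
    using r that unfolding rooted_tree_def by auto
  have par: "par v \<in> inner" if v: "v \<in> P" "v \<noteq> p" for v
  proof (cases "par v = p")
    case False
    have "{par v, v} \<in> B" "{par v, par (par v)} \<in> B" "par (par v) \<noteq> v"
      using e[OF v] e[OF e(2)[OF v] False] by (auto simp: insert_commute)
    then have "\<not> leaf_at B (par v) q" for q unfolding leaf_at_def by metis
    then show ?thesis using e(2)[OF v] unfolding inner_def by blast
  qed (use p in simp)
  have "B = (\<lambda>v. {v, par v}) ` (P - {p})" using r unfolding rooted_tree_def by blast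
  moreover have "inner \<subseteq> P" by (auto simp: inner_def)
  ultimately have "inner_edges = (\<lambda>v. {v, par v}) ` (inner - {p})"
    using par unfolding inner_edges_def by auto
  then have "rooted_tree inner inner_edges p par (rank u p)"
    unfolding rooted_tree_def using p par e(3) by (auto simp: inner_def)
  then show ?thesis by blast
qed

section \<open>Ends of the inner tree\<close>

text \<open>A leaf \<open>p\<close> of the tree of inner vertices, with its neighbour
  \<open>q\<close> in that tree.\<close>

definition end_at :: "point \<Rightarrow> point \<Rightarrow> bool" where
  "end_at p q \<longleftrightarrow> p \<in> inner \<and> q \<in> inner \<and> {p, q} \<in> B \<and> (\<forall>w. {p, w} \<in> B \<longrightarrow> w = q \<or> leaf_at B w p)"

lemma end_atI:
  assumes "p \<in> inner" "q \<in> inner" "{p, q} \<in> B" "\<And>w. w \<in> inner \<Longrightarrow> {p, w} \<in> B \<Longrightarrow> w = q"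
  shows "end_at p q"
proof -
  have "leaf_at B w p" if w: "{p, w} \<in> B" "w \<noteq> q" for w
  proof -
    obtain p' where "leaf_at B w p'" using w assms(4)[of w] edgeD(2) unfolding inner_def by blast
    moreover from this have "p' = p" using edgeD(4)[OF w(1)] unfolding leaf_at_def by blast
    ultimately show ?thesis by simp
  qed
  then show ?thesis using assms unfolding end_at_def by blast
qed

lemma end_leaf_exists: "end_at p q \<Longrightarrow> \<exists>u. leaf_at B u p"
  unfolding end_at_def by (metis inner_second_neighbour)

text \<open>A second neighbour of \<open>q\<close> works: it is neither \<open>q\<close> nor a leaf
  at \<open>p\<close>.\<close>

lemma end_far_vertex_exists:
  assumes "end_at p q" shows "\<exists>x\<in>P. x \<noteq> p \<and> {x, p} \<notin> B"
proof -
  have pq: "q \<in> inner" "{q, p} \<in> B" "p \<noteq> q" using assms edgeD unfolding end_at_def by blast+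
  obtain x where x: "{q, x} \<in> B" "x \<noteq> p" using inner_second_neighbour[OF pq(1,2)] .
  have "{x, p} \<notin> B"
  proof
    assume "{x, p} \<in> B"
    then have "x = q \<or> leaf_at B x p" using assms edgeD(4) unfolding end_at_def by blast
    then show False using x edgeD(3,4)[OF x(1)] pq(3) unfolding leaf_at_def by blast
  qed
  then show ?thesis using x edgeD(2) by blast
qed

text \<open>Passing to parents turns the ray from \<open>p\<close> away from \<open>u\<close> until
  a neighbour of \<open>p\<close> is reached, which must be \<open>q\<close>. So \<open>v\<close>
  lies angularly between \<open>u\<close> and \<open>q\<close>.\<close>

lemma end_side:
  assumes e: "end_at p q" and leaf: "leaf_at B u p"
    and v: "v \<in> P" "v \<noteq> p" "{v, p} \<notin> B"
  shows "0 < orient p u q * orient p u v \<and> 0 < orient p u q * orient p v q"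
  using v
proof (induction "rank u p v" arbitrary: v rule: less_induct)
  case less
  have "v \<noteq> u" using leaf less.prems(3) unfolding leaf_at_def by blast
  then obtain w where w: "{v, w} \<in> B" "convex_quad p u v w"
    using parent_exists[OF leaf] less.prems by blast
  have wP: "w \<in> P" "w \<noteq> p" using edgeD(2)[OF w(1)] convex_quad_distinct[OF w(2)] by auto
  have cq: "0 < orient p u v * orient p u w" "0 < orient p u v * orient p v w"
    using w(2) unfolding convex_quad_def by auto
  show ?case
  proof (cases "{w, p} \<in> B")
    case True
    \<comment> \<open>\<open>w\<close> is adjacent to both \<open>v\<close> and \<open>p\<close>, so
      it is not a leaf.\<close>
    have "w = q"
      using e edgeD(4)[OF True] edgeD(4)[OF w(1)] less.prems(2) unfolding end_at_def leaf_at_def by blast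
    then show ?thesis using cq same_sign_trans[OF cq] by (simp add: mult.commute)
  next
    case False
    have IH: "0 < orient p u q * orient p u w" "0 < orient p u q * orient p w q"
      using less.hyps[OF rank_less[OF w(2) wP(1)] wP False] by auto
    have c: "0 < orient p u w * orient p u q" "0 < orient p u w * orient p u v"
      using IH(1) cq(1) by (simp_all only: mult.commute)
    have 1: "0 < orient p u q * orient p u v" using same_sign_trans[OF c] .
    have c': "0 < orient p u v * orient p u q" using 1 by (simp only: mult.commute)
    have 2: "0 < orient p u q * orient p v w" using same_sign_trans[OF c' cq(2)] .
    have 3: "0 < orient p u q * orient p u q" using same_sign_trans[OF c' c'] .
    \<comment> \<open>At \<open>p\<close>, the rays to \<open>u\<close>, \<open>v\<close>,
      \<open>w\<close>, \<open>q\<close> turn in this order.\<close>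
    show ?thesis using 1 pluecker_sign[OF 1 IH(1) 3 2 IH(2)] by blast
  qed
qed

text \<open>The leaves at \<open>p\<close> lie on one side of \<open>pq\<close>, so the angle at
  \<open>p\<close> orders them. For the leaf \<open>u\<close> farthest from \<open>q\<close>, all of
  \<open>P\<close> lies weakly on one side of the line \<open>pu\<close>.\<close>

lemma end_hull_leaf_exists:
  assumes e: "end_at p q"
  shows "\<exists>u. leaf_at B u p \<and> closed_segment p u \<subseteq> frontier (convex hull P)"
proof -
  obtain x where x: "x \<in> P" "x \<noteq> p" "{x, p} \<notin> B" using end_far_vertex_exists[OF e] by blast
  \<comment> \<open>The side of \<open>pq\<close> that contains \<open>x\<close>; by
    \<open>end_side\<close> it contains every leaf at \<open>p\<close>.\<close>
  define s where "s = orient p x q"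
  have sq: "0 < s * orient p u q" if "leaf_at B u p" for u
    using end_side[OF e that x] by (simp add: s_def mult.commute)
  let ?L = "{u. leaf_at B u p}" and ?R = "\<lambda>a b. 0 < s * orient p a b"
  have "?L \<subseteq> P" unfolding leaf_at_def using edgeD by blast
  then have "finite ?L" using fin by (rule finite_subset)
  moreover have "asymp_on ?L ?R"
    by (rule asymp_onI) (subst orient_swap', simp)
  moreover have "transp_on ?L ?R"
  proof (rule transp_onI)
    fix a b c assume "a \<in> ?L" "b \<in> ?L" "c \<in> ?L" and r: "?R a b" "?R b c"
    then have l: "?R a q" "?R b q" "?R c q" using sq by auto
    \<comment> \<open>The ray to \<open>q\<close> is the common reference, with the order
      reversed.\<close>
    have "0 < - s * orient p c a"
      by (rule pluecker_sign[of "-s" p q c b a])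
        (use l r in \<open>simp_all add: orient_swap'[of p q] orient_swap'[of p c b] orient_swap'[of p b a]\<close>)
    then show "?R a c" by (simp add: orient_swap'[of p c a])
  qed
  moreover have "?L \<noteq> {}" using end_leaf_exists[OF e] by blast
  ultimately obtain u where u: "leaf_at B u p" "\<And>w. leaf_at B w p \<Longrightarrow> w \<noteq> u \<Longrightarrow> \<not> ?R w u"
    using Finite_Set.bex_min_element[of ?L ?R] by blast
  have pu: "p \<in> P" "u \<in> P" "p \<noteq> u" using u(1) edgeD unfolding leaf_at_def by blast+
  have "0 \<le> s * orient p u y" if y: "y \<in> P" for y
  proof -
    have "{y, p} \<in> B \<Longrightarrow> y = q \<or> leaf_at B y p"
      using e edgeD(4)[of y p] unfolding end_at_def by blast
    then consider "y = p" | "y = u" | "y = q" | "leaf_at B y p" "y \<noteq> u" | "y \<noteq> p" "{y, p} \<notin> B"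
      by blast
    then show ?thesis
    proof cases
      case 3
      then show ?thesis using sq[OF u(1)] by simp
    next
      case 4
      then show ?thesis using u(2)[OF 4] by (simp add: orient_swap'[of p y u])
    next
      case 5
      have "0 < orient p u q * orient p u y" "0 < orient p u q * s"
        using end_side[OF e u(1) y 5] sq[OF u(1)] by (auto simp: mult.commute)
      then have "0 < s * orient p u y" by (metis same_sign_trans)
      then show ?thesis by simp
    qed simp_all
  qed
  moreover have "s \<noteq> 0" using sq[OF u(1)] by auto
  ultimately show ?thesis using closed_segment_subset_frontier_hull[OF pu] u(1) by blast
qed

text \<open>The leaves \<open>u\<close> and \<open>u'\<close> have no common neighbour, so
  \<open>block\<close> makes \<open>u u' p' p\<close> convex. There \<open>p u u'\<close> and
  \<open>p' u' u\<close> have opposite orientations, which \<open>end_side\<close> transfers to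
  \<open>q\<close> and \<open>q'\<close>.\<close>

lemma ends_opposite:
  assumes e: "end_at p q" "end_at p' q'" and ne: "p \<noteq> p'" and l: "leaf_at B u p" "leaf_at B u' p'"
  shows "orient p u q * orient p' u' q' < 0"
proof -
  have u: "u \<in> P" "u' \<in> P" using l edgeD unfolding leaf_at_def by blast+
  have ne': "u' \<noteq> p" "u \<noteq> p'" using e l unfolding end_at_def inner_def by blast+
  have nb: "{u', p} \<notin> B" "{u, p'} \<notin> B" using l ne unfolding leaf_at_def by blast+
  have uu: "u \<noteq> u'" "{u, u'} \<notin> B" using l ne ne' unfolding leaf_at_def by blast+
  have "convex_quad u u' p' p" using block[OF u uu] l ne unfolding leaf_at_def by blast
  then have "0 < orient u u' p' * orient u u' p" by (simp add: convex_quad_def)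
  moreover have "orient u u' p = orient p u u'" "orient u u' p' = - orient p' u' u"
    by (simp_all add: orient_def algebra_simps)
  ultimately have *: "orient p u u' * orient p' u' u < 0" by (simp add: mult.commute)
  have "0 < orient p u q * orient p u u'" "0 < orient p' u' q' * orient p' u' u"
    using end_side[OF e(1) l(1) u(2) ne'(1) nb(1)] end_side[OF e(2) l(2) u(1) ne'(2) nb(2)] by auto
  then show ?thesis using * by (auto simp: zero_less_mult_iff mult_less_0_iff)
qed

text \<open>Three reals cannot have pairwise opposite signs.\<close>

lemma no_three_ends:
  assumes "end_at p1 q1" "end_at p2 q2" "end_at p3 q3" "p1 \<noteq> p2" "p1 \<noteq> p3" "p2 \<noteq> p3"
  shows False
proof -
  obtain u1 u2 u3 where u: "leaf_at B u1 p1" "leaf_at B u2 p2" "leaf_at B u3 p3"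
    using end_leaf_exists assms(1-3) by metis
  have "orient p1 u1 q1 * orient p2 u2 q2 < 0" "orient p1 u1 q1 * orient p3 u3 q3 < 0"
    "orient p2 u2 q2 * orient p3 u3 q3 < 0"
    using ends_opposite[OF assms(1,2,4) u(1,2)] ends_opposite[OF assms(1,3,5) u(1,3)]
      ends_opposite[OF assms(2,3,6) u(2,3)] by auto
  then show False by (auto simp: mult_less_0_iff)
qed

section \<open>The inner path and its extension to a spine\<close>

lemma finite_inner: "finite inner"
  using fin by (simp add: inner_def)

lemma finite_inner_edges: "finite inner_edges"
  using finite_B by (simp add: inner_edges_def)

lemma inner_edge_card: "e \<in> inner_edges \<Longrightarrow> e \<subseteq> inner \<and> card e = 2"
  using edge_card by (auto simp: inner_edges_def)

lemma degree_inner: "v \<in> inner \<Longrightarrow> degree inner_edges v = card {w \<in> inner. {v, w} \<in> B}"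
  by (subst degree_eq_card_neighbours) (auto simp: inner_edge_card inner_edge_iff intro: arg_cong[of _ _ card])

lemma degree_inner_pos:
  assumes "v \<in> inner" shows "1 \<le> degree inner_edges v"
proof -
  have "{w \<in> inner. {v, w} \<in> B} \<noteq> {}" using inner_neighbour[of v] assms unfolding inner_def by blast
  then have "card {w \<in> inner. {v, w} \<in> B} \<noteq> 0" using finite_inner by simp
  then show ?thesis using degree_inner[OF assms] by linarith
qed

lemma end_if_degree_inner_1:
  assumes "v \<in> inner" "degree inner_edges v = 1" shows "\<exists>q. end_at v q"
proof -
  obtain q where "{w \<in> inner. {v, w} \<in> B} = {q}"
    using assms degree_inner[OF assms(1)] by (auto simp: card_1_singleton_iff)
  then have "end_at v q" using assms(1) by (intro end_atI) auto
  then show ?thesis ..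
qed

text \<open>Over a tree, the degrees minus 2 sum to -2. Only leaves of the inner tree contribute
  negatively, -1 each, and there are at most two, so no term is positive.\<close>

lemma inner_path:
  "\<exists>xs. distinct xs \<and> set xs = inner \<and> inner_edges = {{xs ! i, xs ! Suc i} | i. i < length xs - 1}"
proof -
  obtain r par rk where t: "rooted_tree inner inner_edges r par rk" using inner_rooted by blast
  have ne: "inner \<noteq> {}" using t unfolding rooted_tree_def by blast
  have card: "card inner_edges = card inner - 1" using rooted_tree_card_edges[OF t finite_inner] .
  have posI: "1 \<le> card inner" using ne finite_inner by (simp add: Suc_le_eq card_gt_0_iff)
  let ?d = "\<lambda>v. int (degree inner_edges v) - 2"
  define D where "D = {v \<in> inner. degree inner_edges v = 1}"
  have "card D \<le> 2"
  proof (rule ccontr)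
    assume "\<not> card D \<le> 2"
    then have "3 \<le> card D" by simp
    then obtain S where S: "S \<subseteq> D" "card S = 3" by (rule obtain_subset_with_card_n)
    obtain a b c where abc: "S = {a, b, c}" "a \<noteq> b" "a \<noteq> c" "b \<noteq> c"
      using S(2) unfolding card_3_iff by metis
    then have D: "a \<in> D" "b \<in> D" "c \<in> D" using S(1) by auto
    have ends: "\<exists>q. end_at v q" if "v \<in> D" for v
      using that end_if_degree_inner_1 unfolding D_def by blast
    obtain qa where "end_at a qa" using ends[OF D(1)] ..
    moreover obtain qb where "end_at b qb" using ends[OF D(2)] ..
    moreover obtain qc where "end_at c qc" using ends[OF D(3)] ..
    ultimately show False using abc(2-4) by (rule no_three_ends)
  qed
  have "(\<Sum>v\<in>inner. ?d v) = int (\<Sum>v\<in>inner. degree inner_edges v) - 2 * int (card inner)"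
    by (simp add: sum_subtractf)
  also have "\<dots> = -2"
    using sum_degree[OF finite_inner finite_inner_edges inner_edge_card] card posI by simp
  finally have total: "(\<Sum>v\<in>inner. ?d v) = -2" .
  have DI: "D \<subseteq> inner" by (auto simp: D_def)
  have "(\<Sum>v\<in>inner. ?d v) = (\<Sum>v\<in>inner - D. ?d v) + (\<Sum>v\<in>D. ?d v)"
    by (rule sum.subset_diff[OF DI finite_inner])
  also have "(\<Sum>v\<in>D. ?d v) = - int (card D)" by (simp add: D_def)
  finally have rest: "(\<Sum>v\<in>inner - D. ?d v) \<le> 0" using total \<open>card D \<le> 2\<close> by linarith
  have nonneg: "0 \<le> ?d v" if "v \<in> inner - D" for v
    using that degree_inner_pos[of v] by (auto simp: D_def)
  have "degree inner_edges v \<le> 2" if v: "v \<in> inner" for v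
  proof (cases "v \<in> D")
    case False
    have "?d v \<le> (\<Sum>v\<in>inner - D. ?d v)"
      by (rule member_le_sum) (use v False nonneg finite_inner in auto)
    then show ?thesis using rest by linarith
  qed (simp add: D_def)
  then show ?thesis
    using path_if_degree_le_2[OF finite_inner finite_inner_edges ne rooted_tree_connected[OF t] card inner_edge_card]
    by blast
qed

lemma caterpillar_B: "caterpillar B"
proof -
  have "path_or_empty inner inner_edges" unfolding path_or_empty_def using inner_path by blast
  then show ?thesis
    unfolding caterpillar_def Let_def using is_tree_B by (simp add: inner_eq[symmetric] inner_edges_def)
qed

text \<open>All vertices of a path except its two endpoints have two distinct neighbours, hence are
  inner.\<close>

lemma gpath_length_le:
  assumes "is_gpath B ys" shows "length ys \<le> card inner + 2"
proof (cases "length ys \<le> 2")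
  case False
  have d: "distinct ys" and edge: "\<And>i. Suc i < length ys \<Longrightarrow> {ys ! i, ys ! Suc i} \<in> B"
    using assms unfolding is_gpath_def is_walk_def by auto
  let ?J = "{1..<length ys - 1}"
  have "ys ! i \<in> inner" if i: "i \<in> ?J" for i
  proof -
    have "{ys ! i, ys ! Suc i} \<in> B" "{ys ! i, ys ! (i - 1)} \<in> B"
      using edge[of i] edge[of "i - 1"] i by (auto simp: insert_commute)
    moreover have "ys ! Suc i \<noteq> ys ! (i - 1)"
    proof -
      have "Suc i < length ys" "i - 1 < length ys" "Suc i \<noteq> i - 1" using i by auto
      then show ?thesis using nth_eq_iff_index_eq[OF d] by blast
    qed
    ultimately show ?thesis unfolding inner_def leaf_at_def using edgeD(1) by blast
  qed
  then have "(\<lambda>i. ys ! i) ` ?J \<subseteq> inner" by blast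
  then have "card ((\<lambda>i. ys ! i) ` ?J) \<le> card inner" using finite_inner by (rule card_mono[rotated])
  moreover have "inj_on (\<lambda>i. ys ! i) ?J" using d by (intro inj_onI) (auto simp: nth_eq_iff_index_eq)
  ultimately show ?thesis by (simp add: card_image)
qed simp

text \<open>Prolonging the inner path by a hull leaf at each end attains the bound of
  \<open>gpath_length_le\<close>.\<close>

lemma hull_spine_exists:
  "\<exists>xs. is_spine B xs \<and> length xs \<ge> 2 \<and>
     closed_segment (xs ! 0) (xs ! 1) \<subseteq> frontier (convex hull P) \<and>
     closed_segment (xs ! (length xs - 2)) (xs ! (length xs - 1)) \<subseteq> frontier (convex hull P)"
proof -
  obtain xs where d: "distinct xs" and set: "set xs = inner"
    and ie: "inner_edges = {{xs ! i, xs ! Suc i} | i. i < length xs - 1}" using inner_path by blast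
  have card: "length xs = card inner" using d set by (simp flip: distinct_card)
  \<comment> \<open>Two adjacent inner vertices ensure that the inner path has two different
    ends.\<close>
  obtain a where "a \<in> inner" using leaf_exists leaf_neighbour_inner by blast
  moreover from this obtain b where "b \<in> inner" "{a, b} \<in> B"
    using inner_neighbour[of a] unfolding inner_def by blast
  ultimately have "{a, b} \<subseteq> inner" "card {a, b} = 2" using edge_card by auto
  then have len: "2 \<le> length xs" using card card_mono[OF finite_inner, of "{a, b}"] by simp
  define n where "n = length xs - 1"
  have n: "1 \<le> n" "length xs = Suc n" using len by (auto simp: n_def)
  have xin: "xs ! i \<in> inner" if "i \<le> n" for i using that n set nth_mem[of i xs] by simp
  have edge: "{xs ! i, xs ! Suc i} \<in> B" if "i < n" for i
    using that ie n_def unfolding inner_edges_def by blast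
  have adj: "j = Suc i \<or> i = Suc j" if "i \<le> n" "j \<le> n" "{xs ! i, xs ! j} \<in> B" for i j
  proof -
    have "{xs ! i, xs ! j} \<in> inner_edges" using that xin by (simp add: inner_edge_iff)
    then obtain k where "k < n" "{xs ! i, xs ! j} = {xs ! k, xs ! Suc k}" unfolding ie n_def by blast
    then show ?thesis using d n that by (auto simp: doubleton_eq_iff nth_eq_iff_index_eq)
  qed
  have idx: "\<exists>j\<le>n. w = xs ! j" if "w \<in> inner" for w
    using that set n by (metis in_set_conv_nth less_Suc_eq_le)
  have "end_at (xs ! 0) (xs ! 1)"
  proof (rule end_atI)
    fix w assume "w \<in> inner" "{xs ! 0, w} \<in> B"
    then obtain j where j: "j \<le> n" "w = xs ! j" "{xs ! 0, xs ! j} \<in> B" using idx by blast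
    then have "j = 1" using adj[of 0 j] by auto
    then show "w = xs ! 1" using j by simp
  qed (use xin n edge[of 0] in auto)
  then obtain u where u: "leaf_at B u (xs ! 0)" "closed_segment (xs ! 0) u \<subseteq> frontier (convex hull P)"
    using end_hull_leaf_exists by blast
  have "end_at (xs ! n) (xs ! (n - 1))"
  proof (rule end_atI)
    fix w assume "w \<in> inner" "{xs ! n, w} \<in> B"
    then obtain j where j: "j \<le> n" "w = xs ! j" "{xs ! n, xs ! j} \<in> B" using idx by blast
    then have "n = Suc j" using adj[of n j] by auto
    then show "w = xs ! (n - 1)" using j by simp
  qed (use xin n edge[of "n - 1"] in \<open>auto simp: insert_commute\<close>)
  then obtain u' where u': "leaf_at B u' (xs ! n)" "closed_segment (xs ! n) u' \<subseteq> frontier (convex hull P)"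
    using end_hull_leaf_exists by blast
  let ?ys = "u # xs @ [u']"
  have e: "{u, xs ! 0} \<in> B" "{xs ! n, u'} \<in> B"
    using u(1) u'(1) unfolding leaf_at_def by (auto simp: insert_commute)
  have y0: "?ys ! 0 = u" "?ys ! 1 = xs ! 0" using n by (simp_all add: nth_append)
  have yn: "?ys ! Suc n = xs ! n" "?ys ! Suc (Suc n) = u'" using n by (simp_all add: nth_append)
  have ym: "?ys ! Suc i = xs ! i" if "i \<le> n" for i using that n by (simp add: nth_append)
  have "{?ys ! i, ?ys ! Suc i} \<in> B" if i: "i < length ?ys - 1" for i
  proof -
    consider "i = 0" | "i = Suc n" | j where "i = Suc j" "j < n"
      using i n by (cases i) (auto simp: less_Suc_eq)
    then show ?thesis
    proof cases
      case (3 j)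
      then show ?thesis using ym[of j] ym[of "Suc j"] edge[of j] by simp
    qed (use e y0 yn in auto)
  qed
  then have walk: "is_walk B ?ys" by (simp add: is_walk_def)
  have "u \<notin> inner" "u' \<notin> inner" using u(1) u'(1) unfolding inner_def by blast+
  \<comment> \<open>A common leaf would have both ends of the inner path as neighbours.\<close>
  moreover have "u \<noteq> u'"
  proof
    assume "u = u'"
    then have "xs ! 0 = xs ! n" using u(1) u'(1) unfolding leaf_at_def by blast
    then show False using d n by (simp add: nth_eq_iff_index_eq)
  qed
  ultimately have "is_gpath B ?ys" using walk d set by (simp add: is_gpath_def)
  moreover have "length ?ys = card inner + 2" using card by simp
  ultimately have "is_spine B ?ys" unfolding is_spine_def using gpath_length_le by metis
  moreover have "length ?ys - 2 = Suc n" "length ?ys - 1 = Suc (Suc n)" using n by simp_all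
  ultimately show ?thesis
    using u(2) u'(2) y0 yn by (intro exI[of _ ?ys]) (simp add: closed_segment_commute)
qed

end

section \<open>Simple double stars\<close>

text \<open>Without an edge at \<open>v\<close>, the set \<open>{v}\<close> would be closed under
  adjacency in \<open>T\<close>.\<close>

lemma spanning_tree_star_edge:
  assumes "spanning_tree P T" "v \<in> P" "x \<in> P" "x \<noteq> v"
  shows "star_of P v \<inter> T \<noteq> {}"
proof
  assume no: "star_of P v \<inter> T = {}"
  have "b \<in> {v}" if "{a, b} \<in> T" "a \<in> {v}" for a b
  proof -
    have "{v, b} \<in> complete_edges P" "{v, b} \<in> T" using that assms(1) unfolding spanning_tree_def by auto
    then have "{v, b} \<in> star_of P v"
      unfolding complete_edges_def star_of_def by (auto simp: doubleton_eq_iff)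
    then show ?thesis using no \<open>{v, b} \<in> T\<close> by blast
  qed
  then have "P \<subseteq> {v}"
    using connected_on_closed[of P T v "{v}"] assms unfolding spanning_tree_def by blast
  then show False using assms by blast
qed

lemma star_of_subset: "v \<in> P \<Longrightarrow> star_of P v \<subseteq> complete_edges P"
  unfolding star_of_def complete_edges_def by blast

lemma card_star_of: "finite P \<Longrightarrow> v \<in> P \<Longrightarrow> card (star_of P v) \<le> card P - 1"
proof -
  assume a: "finite P" "v \<in> P"
  have "star_of P v = (\<lambda>w. {v, w}) ` (P - {v})" unfolding star_of_def by blast
  then show ?thesis using a card_image_le[of "P - {v}" "\<lambda>w. {v, w}"] by simp
qed

text \<open>The empty tree cannot be blocked, so the existence of a blocker forces two
  points.\<close>

lemma simple_trees_trivial: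
  assumes "\<And>u v. u \<in> P \<Longrightarrow> v \<in> P \<Longrightarrow> u = v"
  shows "{} \<in> simple_trees_diam_le P k"
proof -
  have w: "is_walk {} [v] \<and> hd [v] = v \<and> last [v] = v \<and> length [v] \<le> k + 1" for v :: point
    by (simp add: is_walk_def)
  have "\<not> is_gpath {} xs" if "3 \<le> length xs" for xs :: "point list"
  proof -
    have "0 < length xs - 1" using that by simp
    then show ?thesis unfolding is_gpath_def is_walk_def by blast
  qed
  then have "acyclic_graph ({} :: point set set)" unfolding acyclic_graph_def by blast
  moreover have "diam_le P {} k" unfolding diam_le_def using assms w by metis
  moreover have "connected_on P {}" unfolding connected_on_def using assms w by metis
  ultimately show ?thesis
    unfolding simple_trees_diam_le_def spanning_tree_def noncrossing_def by simp
qed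

text \<open>The centres are swapped by \<open>h\<close>, so that their joining edge is also of the form \<open>{x, h x}\<close>.\<close>

definition double_star :: "'a set \<Rightarrow> ('a \<Rightarrow> 'a) \<Rightarrow> 'a set set" where
  "double_star P h = (\<lambda>x. {x, h x}) ` P"

context
  fixes P :: "point set" and u v :: point and h :: "point \<Rightarrow> point"
  assumes uv: "u \<in> P" "v \<in> P" "u \<noteq> v" and h: "\<And>x. x \<in> P \<Longrightarrow> h x = u \<or> h x = v"
    and huv: "h u = v" "h v = u"
begin

lemma double_star_attach: "x \<in> P \<Longrightarrow> {x, h x} \<in> double_star P h" "x \<in> P \<Longrightarrow> {h x, x} \<in> double_star P h"
  unfolding double_star_def by (auto simp: insert_commute)

lemma double_star_attach_neq: "x \<in> P \<Longrightarrow> h x \<noteq> x"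
  using h[of x] huv uv by metis

lemma double_star_rooted:
  "rooted_tree P (double_star P h) u h (\<lambda>x. if x = u then 0 else if x = v then 1 else (2::nat))"
proof -
  have "(\<lambda>x. {x, h x}) ` P \<subseteq> (\<lambda>x. {x, h x}) ` (P - {u})"
  proof (rule image_subsetI)
    fix x assume "x \<in> P"
    moreover have "{u, h u} = {v, h v}" using huv by auto
    ultimately show "{x, h x} \<in> (\<lambda>x. {x, h x}) ` (P - {u})"
      using uv by (cases "x = u") auto
  qed
  then have "double_star P h = (\<lambda>x. {x, h x}) ` (P - {u})" unfolding double_star_def by blast
  then show ?thesis unfolding rooted_tree_def using uv huv h by fastforce
qed

lemma double_star_diam: "diam_le P (double_star P h) 3"
  unfolding diam_le_def
proof (intro ballI)
  fix a b assume ab: "a \<in> P" "b \<in> P"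
  note e = double_star_attach[OF ab(1)] double_star_attach[OF ab(2)]
  show "\<exists>xs. is_walk (double_star P h) xs \<and> hd xs = a \<and> last xs = b \<and> length xs \<le> 3 + 1"
  proof (cases "h a = h b")
    case True
    then have "is_walk (double_star P h) [a, h a, b]" using e by (auto simp: is_walk_def less_Suc_eq)
    then show ?thesis by (intro exI[of _ "[a, h a, b]"]) simp
  next
    case False
    then have "{h a, h b} = {u, h u}" using h[OF ab(1)] h[OF ab(2)] huv by auto
    then have "{h a, h b} \<in> double_star P h" using double_star_attach(1)[OF uv(1)] by simp
    then have "is_walk (double_star P h) [a, h a, h b, b]" using e by (auto simp: is_walk_def less_Suc_eq)
    then show ?thesis by (intro exI[of _ "[a, h a, h b, b]"]) simp
  qed
qed

text \<open>Edges with a common endpoint meet only there by general position. Disjoint edges hang on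
  different centres and cross only if they are the diagonals of a convex quadrilateral.\<close>

lemma double_star_noncrossing:
  assumes gp: "general_position P"
    and nq: "\<And>x y. x \<in> P \<Longrightarrow> y \<in> P \<Longrightarrow> h x = u \<Longrightarrow> h y = v \<Longrightarrow> \<not> convex_quad u v x y"
  shows "noncrossing (double_star P h)"
proof -
  have hP: "h x \<in> P" if "x \<in> P" for x using h[OF that] uv by auto
  have common: "closed_segment z x \<inter> closed_segment z y \<subseteq> {z, x} \<inter> {z, y}"
    if "z \<in> P" "x \<in> P" "y \<in> P" "x \<noteq> y" "z \<noteq> x" "z \<noteq> y" for x y z
    using closed_segments_common_endpoint[OF orient_general_position[OF gp that(1-3,5,6,4)]] by simp
  have disj: "closed_segment x u \<inter> closed_segment y v = {}"
    if "x \<in> P" "y \<in> P" "h x = u" "h y = v" "x \<noteq> v" "y \<noteq> u" "x \<noteq> y" for x y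
  proof -
    have "x \<noteq> u" "y \<noteq> v" using that double_star_attach_neq by blast+
    then have "distinct [u, v, x, y]" using that uv(3) by auto
    then show ?thesis
      using closed_segments_disjoint[OF gp uv(1,2) that(1,2)] nq[OF that(1-4)]
      by (simp add: closed_segment_commute)
  qed
  have main: "closed_segment x (h x) \<inter> closed_segment y (h y) \<subseteq> {x, h x} \<inter> {y, h y}"
    if x: "x \<in> P" and y: "y \<in> P" and ne: "{x, h x} \<noteq> {y, h y}" for x y
  proof -
    note n = double_star_attach_neq[OF x] double_star_attach_neq[OF y]
    have xy: "x \<noteq> y" using ne by auto
    consider "h x = h y" | "h x = y" | "h y = x" | "h x \<noteq> h y" "h x \<noteq> y" "h y \<noteq> x" by blast
    then show ?thesis
    proof cases
      case 1
      then show ?thesis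
        using common[of "h x" x y] hP[OF x] x y xy n by (simp add: closed_segment_commute insert_commute)
    next
      case 2
      then have "x \<noteq> h y" using ne by auto
      then show ?thesis
        using common[of y x "h y"] 2 hP[OF y] x y xy n by (simp add: closed_segment_commute insert_commute)
    next
      case 3
      then have "h x \<noteq> y" using ne by auto
      then show ?thesis
        using common[of x "h x" y] 3 hP[OF x] x y xy n by (simp add: closed_segment_commute insert_commute)
    next
      case 4
      consider "h x = u" "h y = v" | "h x = v" "h y = u" using 4(1) h[OF x] h[OF y] by auto
      then show ?thesis
      proof cases
        case 1
        then show ?thesis using disj[of x y] 4 x y xy by auto
      next
        case 2
        then show ?thesis using disj[of y x] 4 x y xy by auto
      qed
    qed
  qed
  have seg: "closed_segment a b = closed_segment c d" if "{a, b} = {c, d}" for a b c d :: point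
    using that by (metis closed_segment_commute doubleton_eq_iff)
  show ?thesis unfolding noncrossing_def
  proof (intro allI impI)
    fix a b c d
    assume e: "{a, b} \<in> double_star P h" "{c, d} \<in> double_star P h" "{a, b} \<noteq> {c, d}"
    obtain x y where xy: "x \<in> P" "y \<in> P" "{a, b} = {x, h x}" "{c, d} = {y, h y}"
      using e(1,2) unfolding double_star_def by blast
    show "closed_segment a b \<inter> closed_segment c d \<subseteq> {a, b} \<inter> {c, d}"
      unfolding seg[OF xy(3)] seg[OF xy(4)] unfolding xy(3,4)
      using main[OF xy(1,2)] e(3) unfolding xy(3,4) .
  qed
qed

lemma double_star_simple_tree:
  assumes "general_position P"
    and "\<And>x y. x \<in> P \<Longrightarrow> y \<in> P \<Longrightarrow> h x = u \<Longrightarrow> h y = v \<Longrightarrow> \<not> convex_quad u v x y"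
  shows "double_star P h \<in> simple_trees_diam_le P 3"
proof -
  have "double_star P h \<subseteq> complete_edges P"
  proof
    fix e assume "e \<in> double_star P h"
    then obtain x where x: "x \<in> P" "e = {x, h x}" unfolding double_star_def by blast
    have "h x \<in> P" "x \<noteq> h x" using h[OF x(1)] uv double_star_attach_neq[OF x(1)] by auto
    then show "e \<in> complete_edges P" unfolding complete_edges_def using x by blast
  qed
  then show ?thesis
    unfolding simple_trees_diam_le_def spanning_tree_def
    using double_star_diam double_star_noncrossing[OF assms] rooted_tree_connected[OF double_star_rooted]
      rooted_tree_acyclic[OF double_star_rooted] by blast
qed

end

section \<open>From blocking to the local condition\<close>

text \<open>Otherwise the neighbours of \<open>v\<close> can be attached to \<open>u\<close> and
  those of \<open>u\<close> to \<open>v\<close> without crossings, giving a simple double star that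
  avoids \<open>B\<close>.\<close>

lemma blocks_imp_quad:
  assumes gp: "general_position P" and blocks: "blocks (simple_trees_diam_le P 3) B"
    and uv: "u \<in> P" "v \<in> P" "u \<noteq> v" "{u, v} \<notin> B"
  shows "\<exists>w w'. {v, w} \<in> B \<and> {u, w'} \<in> B \<and> (w = w' \<or> convex_quad u v w w')"
proof (rule ccontr)
  assume no: "\<not> ?thesis"
  \<comment> \<open>\<open>U\<close> is the least set that contains the neighbours of \<open>v\<close> and can be joined to \<open>u\<close>, and its
    complement to \<open>v\<close>, without crossings.\<close>
  define U where "U = {x. {v, x} \<in> B \<or> (\<exists>w. {v, w} \<in> B \<and> convex_quad u v w x)}"
  define h where "h x = (if x = u then v else if x = v then u else if x \<in> U then u else v)" for x
  have h: "h x = u \<or> h x = v" "h u = v" "h v = u" for x using uv by (auto simp: h_def)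
  have "\<not> convex_quad u v x y" if hx: "h x = u" "h y = v" for x y
  proof
    assume q: "convex_quad u v x y"
    note d = convex_quad_distinct[OF q]
    have "x \<in> U" "y \<notin> U" using hx d uv(3) by (auto simp: h_def split: if_splits)
    \<comment> \<open>\<open>U\<close> is closed upwards by transitivity, so it would contain
      \<open>y\<close>.\<close>
    then show False using q convex_quad_trans[of u v _ x y] unfolding U_def by blast
  qed
  then have "double_star P h \<in> simple_trees_diam_le P 3"
    using double_star_simple_tree[of u P v h] uv h gp by blast
  then have "B \<inter> double_star P h \<noteq> {}" using blocks unfolding blocks_def by blast
  then obtain x where x: "x \<in> P" "{x, h x} \<in> B" unfolding double_star_def by auto
  consider "x = u \<or> x = v" | "x \<noteq> u" "x \<noteq> v" "x \<in> U" | "x \<noteq> u" "x \<noteq> v" "x \<notin> U" by blast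
  then show False
  proof cases
    case 1
    then show False using x h(2,3) uv(4) by (auto simp: insert_commute)
  next
    case 2
    then have "{u, x} \<in> B" using x by (simp add: h_def insert_commute)
    \<comment> \<open>\<open>x\<close> is a common neighbour of the centres, or it can serve as
      \<open>w'\<close>.\<close>
    then show False using no 2(3) unfolding U_def by blast
  next
    case 3
    then have "{v, x} \<in> B" using x by (simp add: h_def insert_commute)
    then show False using 3(3) unfolding U_def by blast
  qed
qed

lemma blocker_double_star_blocker:
  assumes fin: "finite P" and gp: "general_position P"
    and bl: "is_blocker P (simple_trees_diam_le P 3) B"
  shows "double_star_blocker P B"
proof -
  have B: "B \<subseteq> complete_edges P" "blocks (simple_trees_diam_le P 3) B"
    and min: "\<And>B'. B' \<subseteq> complete_edges P \<Longrightarrow> blocks (simple_trees_diam_le P 3) B' \<Longrightarrow> card B \<le> card B'"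
    using bl unfolding is_blocker_def by blast+
  have "{} \<notin> simple_trees_diam_le P 3" using B(2) unfolding blocks_def by blast
  then obtain u v where uv: "u \<in> P" "v \<in> P" "u \<noteq> v" using simple_trees_trivial by blast
  have "card {u, v} \<le> card P" using uv fin by (intro card_mono) auto
  then have c: "2 \<le> card P" using uv by simp
  have "blocks (simple_trees_diam_le P 3) (star_of P v)"
    unfolding blocks_def simple_trees_diam_le_def using spanning_tree_star_edge[OF _ uv(2,1,3)] by blast
  then have "card B \<le> card (star_of P v)" by (rule min[OF star_of_subset[OF uv(2)]])
  also have "\<dots> \<le> card P - 1" by (rule card_star_of[OF fin uv(2)])
  finally show ?thesis
    using fin gp B c blocks_imp_quad[OF gp B(2)] by unfold_locales
qed

theorem theorem6:
  fixes P :: "point set" and B :: "point set set"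
  assumes "finite P" and "general_position P"
    and "is_blocker P (simple_trees_diam_le P 3) B"
  shows "(\<exists>v\<in>P. B = star_of P v) \<or>
         (caterpillar B \<and>
          (\<exists>xs. is_spine B xs \<and> length xs \<ge> 2 \<and>
                closed_segment (xs ! 0) (xs ! 1) \<subseteq> frontier (convex hull P) \<and>
                closed_segment (xs ! (length xs - 2)) (xs ! (length xs - 1))
                  \<subseteq> frontier (convex hull P)))"
proof (cases "\<exists>v\<in>P. B = star_of P v")
  case False
  interpret double_star_blocker P B using assms by (rule blocker_double_star_blocker)
  interpret non_star_blocker P B using False by unfold_locales blast
  show ?thesis using caterpillar_B hull_spine_exists by blast
qed simp

end
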